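(* Let $\Gamma$ be a numerical semigroup with embedding dimension $e$, delta-invariant $\delta$ and Eliahou number $E(\Gamma)<0$. Then $$W_\Gamma(e)<e_c\,\delta.$$ In particular, $\mu_\Gamma>e_s$.
   Context: $\mathbb{N}$ denotes the set of nonnegative integers. A numerical semigroup $\Gamma$ is an additive submonoid of $(\mathbb{N},+)$ whose elements have greatest common divisor $1$, so that $\mathbb{N}\setminus\Gamma$ is finite; it is assumed that $\Gamma\neq\mathbb{N}$. The multiplicity is $m=m(\Gamma)=\min(\Gamma\setminus\{0\})$, the conductor is $c=c(\Gamma)=\max(\mathbb{N}\setminus\Gamma)+1$, and the delta-invariant $\delta=\delta(\Gamma)$ is the number of elements of $\Gamma$ (including $0$) that are smaller than $c$. $G$ denotes the (finite, unique) minimal system of generators of $\Gamma$, and $e=e(\Gamma)=|G|$ is the embedding dimension. The Wilf function is $W_\Gamma:\mathbb{N}\to\mathbb{Z}$, $W_\Gamma(k)=k\,\delta(\Gamma)-c(\Gamma)$, and $\mu_\Gamma=\min\{k\in\mathbb{N} : W_\Gamma(k)\geq 0\}$. Eliahou number: put $q=\lceil c/m\rceil$, $\nu=qm-c$, $J_q=\{c,c+1,\ldots,c+m-1\}$, $p_q=J_q\cap G$, $d_q=J_q\setminus p_q$, $e_s=|\{g\in G : g<c\}|$ and $e_c=|p_q|$ (so that $e=e_s+e_c$). Then $E(\Gamma)=e_s\,\delta(\Gamma)-q\,|d_q|+\nu$. *)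

theory Defs
  imports Complex_Main
begin

definition additive_submonoid :: "nat set \<Rightarrow> bool" where
  "additive_submonoid S \<longleftrightarrow> 0 \<in> S \<and> (\<forall>x\<in>S. \<forall>y\<in>S. x + y \<in> S)"

text \<open>The full semigroup of all naturals satisfies this predicate; that it is excluded
  is a separate hypothesis where needed.\<close>

definition numerical_semigroup :: "nat set \<Rightarrow> bool" where
  "numerical_semigroup \<Gamma> \<longleftrightarrow> additive_submonoid \<Gamma> \<and> Gcd \<Gamma> = 1"

definition multiplicity :: "nat set \<Rightarrow> nat" where
  "multiplicity \<Gamma> = (LEAST x. x \<in> \<Gamma> - {0})"

text \<open>Meaningful when the complement of \<open>\<Gamma>\<close> is finite and nonempty, as it is for a
  numerical semigroup other than the set of all naturals.\<close>

definition conductor :: "nat set \<Rightarrow> nat" where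
  "conductor \<Gamma> = Max (UNIV - \<Gamma>) + 1"

definition delta :: "nat set \<Rightarrow> nat" where
  "delta \<Gamma> = card {x \<in> \<Gamma>. x < conductor \<Gamma>}"

definition generates :: "nat set \<Rightarrow> nat set \<Rightarrow> bool" where
  "generates A \<Gamma> \<longleftrightarrow> additive_submonoid hull A = \<Gamma>"

definition is_minimal_generators :: "nat set \<Rightarrow> nat set \<Rightarrow> bool" where
  "is_minimal_generators A \<Gamma> \<longleftrightarrow> generates A \<Gamma> \<and> (\<forall>B. B \<subset> A \<longrightarrow> \<not> generates B \<Gamma>)"

text \<open>Existence and uniqueness are proved in \<open>ex1_minimal_generators\<close> below.\<close>

definition minimal_generators :: "nat set \<Rightarrow> nat set" where
  "minimal_generators \<Gamma> = (THE A. is_minimal_generators A \<Gamma>)"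

definition embedding_dimension :: "nat set \<Rightarrow> nat" where
  "embedding_dimension \<Gamma> = card (minimal_generators \<Gamma>)"

definition Wilf :: "nat set \<Rightarrow> nat \<Rightarrow> int" where
  "Wilf \<Gamma> k = int k * int (delta \<Gamma>) - int (conductor \<Gamma>)"

definition mu :: "nat set \<Rightarrow> nat" where
  "mu \<Gamma> = (LEAST k. Wilf \<Gamma> k \<ge> 0)"

definition depth :: "nat set \<Rightarrow> int" where
  "depth \<Gamma> = \<lceil>real (conductor \<Gamma>) / real (multiplicity \<Gamma>)\<rceil>"

definition nu :: "nat set \<Rightarrow> int" where
  "nu \<Gamma> = depth \<Gamma> * int (multiplicity \<Gamma>) - int (conductor \<Gamma>)"

definition Jq :: "nat set \<Rightarrow> nat set" where
  "Jq \<Gamma> = {conductor \<Gamma> ..< conductor \<Gamma> + multiplicity \<Gamma>}"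

definition pq :: "nat set \<Rightarrow> nat set" where
  "pq \<Gamma> = Jq \<Gamma> \<inter> minimal_generators \<Gamma>"

definition dq :: "nat set \<Rightarrow> nat set" where
  "dq \<Gamma> = Jq \<Gamma> - pq \<Gamma>"

definition e_s :: "nat set \<Rightarrow> nat" where
  "e_s \<Gamma> = card {g \<in> minimal_generators \<Gamma>. g < conductor \<Gamma>}"

definition e_c :: "nat set \<Rightarrow> nat" where
  "e_c \<Gamma> = card (pq \<Gamma>)"

definition Eliahou :: "nat set \<Rightarrow> int" where
  "Eliahou \<Gamma> = int (e_s \<Gamma>) * int (delta \<Gamma>) - depth \<Gamma> * int (card (dq \<Gamma>)) + nu \<Gamma>"

lemma additive_submonoid_hull: "additive_submonoid (additive_submonoid hull A)"
  by (rule hull_in) (auto simp: additive_submonoid_def)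

lemma ex1_minimal_generators:
  assumes \<Gamma>: "additive_submonoid \<Gamma>"
  shows "\<exists>!A. is_minimal_generators A \<Gamma>"
proof -
  define P where "P = {x \<in> \<Gamma>. x \<noteq> 0 \<and> \<not> (\<exists>a\<in>\<Gamma>. \<exists>b\<in>\<Gamma>. a \<noteq> 0 \<and> b \<noteq> 0 \<and> x = a + b)}"
  have "x \<in> \<Gamma> \<Longrightarrow> x \<in> additive_submonoid hull P" for x
  proof (induction x rule: less_induct)
    case (less x)
    have H: "0 \<in> additive_submonoid hull P"
      "\<And>a b. a \<in> additive_submonoid hull P \<Longrightarrow> b \<in> additive_submonoid hull P
        \<Longrightarrow> a + b \<in> additive_submonoid hull P"
      using additive_submonoid_hull[of P] unfolding additive_submonoid_def[of "_ hull _"] by auto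
    consider "x = 0" | "x \<in> P" | a b where "a \<in> \<Gamma>" "b \<in> \<Gamma>" "a \<noteq> 0" "b \<noteq> 0" "x = a + b"
      using less.prems by (auto simp: P_def)
    then show ?case
    proof cases
      case 3
      then show ?thesis using less.IH[of a] less.IH[of b] H by auto
    qed (use H in \<open>auto intro: hull_inc\<close>)
  qed
  moreover have "additive_submonoid hull P \<subseteq> \<Gamma>"
    using \<Gamma> by (intro hull_minimal) (auto simp: P_def)
  ultimately have gen: "generates P \<Gamma>"
    by (auto simp: generates_def)
  have least: "P \<subseteq> A" if "generates A \<Gamma>" for A
  proof
    fix x assume x: "x \<in> P"
    show "x \<in> A"
    proof (rule ccontr)
      assume "x \<notin> A"
      moreover have "A \<subseteq> \<Gamma>"
        using that hull_subset[of A additive_submonoid] by (simp add: generates_def)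
      moreover have "additive_submonoid (\<Gamma> - {x})"
        unfolding additive_submonoid_def
      proof (intro conjI ballI)
        show "0 \<in> \<Gamma> - {x}"
          using \<Gamma> x by (auto simp: additive_submonoid_def P_def)
        fix a b assume ab: "a \<in> \<Gamma> - {x}" "b \<in> \<Gamma> - {x}"
        then have "a + b \<in> \<Gamma>"
          using \<Gamma> by (auto simp: additive_submonoid_def)
        moreover have "a + b \<noteq> x"
        proof
          assume "a + b = x"
          with ab have "a \<noteq> 0" "b \<noteq> 0" by auto
          with ab x \<open>a + b = x\<close> show False by (auto simp: P_def)
        qed
        ultimately show "a + b \<in> \<Gamma> - {x}" by simp
      qed
      ultimately have "additive_submonoid hull A \<subseteq> \<Gamma> - {x}"
        by (intro hull_minimal) auto
      with that x show False by (auto simp: generates_def P_def)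
    qed
  qed
  show ?thesis
  proof (rule ex1I[of _ P])
    show "is_minimal_generators P \<Gamma>"
      using gen least by (auto simp: is_minimal_generators_def)
    show "A = P" if "is_minimal_generators A \<Gamma>" for A
      using that gen least[of A] by (auto simp: is_minimal_generators_def)
  qed
qed

end

theory Submission
  imports Defs
begin

text \<open>
  Write \<open>q\<close> for the depth. Both conclusions express that \<open>e\<^sub>s \<delta> < c\<close>. Substituting
  \<open>\<nu> = q m - c\<close> into the Eliahou number gives
  \<open>E(\<Gamma>) = e\<^sub>s \<delta> - c + q (m - |d\<^sub>q|)\<close>, and the last summand is nonnegative because \<open>d\<^sub>q\<close> is a
  subset of the interval \<open>J\<^sub>q\<close> of \<open>m\<close> integers. Hence \<open>E(\<Gamma>) < 0\<close> forces \<open>e\<^sub>s \<delta> < c\<close>, which says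
  that the Wilf function is still negative at \<open>e\<^sub>s\<close>. As that function is nondecreasing and
  eventually nonnegative, its first nonnegative value occurs after \<open>e\<^sub>s\<close>; and
  \<open>e \<le> e\<^sub>s + e\<^sub>c\<close> turns \<open>e\<^sub>s \<delta> < c\<close> into the bound on \<open>W\<^sub>\<Gamma>(e)\<close>.

  The inequality \<open>e \<le> e\<^sub>s + e\<^sub>c\<close> holds since no minimal generator is \<open>c + m\<close> or more
  (\<open>minimal_generator_less\<close>): such a number splits as \<open>m\<close> plus an element of \<open>\<Gamma>\<close> beyond the
  conductor, while minimal generators are irreducible
  (\<open>minimal_generator_not_sum\<close>). That everything beyond the conductor lies in \<open>\<Gamma>\<close> rests on the
  finiteness of the complement of \<open>\<Gamma>\<close> (\<open>finite_gaps\<close>).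
\<close>

lemma additive_submonoid_mult:
  assumes "additive_submonoid S" "x \<in> S"
  shows "k * x \<in> S"
  using assms by (induction k) (auto simp: additive_submonoid_def)

lemma numerical_semigroup_pos_element:
  assumes "numerical_semigroup \<Gamma>"
  obtains x where "x \<in> \<Gamma>" "x > 0"
proof -
  have "\<not> \<Gamma> \<subseteq> {0}"
  proof
    assume "\<Gamma> \<subseteq> {0}"
    then have "Gcd \<Gamma> = 0" by (simp add: Gcd_0_iff)
    with assms show False by (simp add: numerical_semigroup_def)
  qed
  then show ?thesis using that by auto
qed

text \<open>The differences of elements of \<open>\<Gamma>\<close> form a subgroup of the integers. Its positive generator
  \<open>d\<close> divides every element of \<open>\<Gamma>\<close>, so \<open>d = 1\<close>.\<close>

lemma numerical_semigroup_consecutive: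
  assumes "numerical_semigroup \<Gamma>"
  obtains n where "n \<in> \<Gamma>" "n + 1 \<in> \<Gamma>"
proof -
  have S: "additive_submonoid \<Gamma>" and gcd: "Gcd \<Gamma> = 1"
    using assms by (auto simp: numerical_semigroup_def)
  define P where "P = (\<lambda>d::nat. d > 0 \<and> (\<exists>n\<in>\<Gamma>. n + d \<in> \<Gamma>))"
  obtain y where "y \<in> \<Gamma>" "y > 0"
    using numerical_semigroup_pos_element[OF assms] .
  then have "P y"
    using S by (auto simp: P_def additive_submonoid_def intro!: bexI[of _ 0])
  define d where "d = (LEAST d. P d)"
  have "P d"
    unfolding d_def using \<open>P y\<close> by (rule LeastI)
  then obtain n where n: "n \<in> \<Gamma>" "n + d \<in> \<Gamma>" and "d > 0"
    by (auto simp: P_def)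
  have "d dvd x" if "x \<in> \<Gamma>" for x
  proof (rule ccontr)
    assume "\<not> d dvd x"
    then have "x mod d > 0" by (auto simp: dvd_eq_mod_eq_0)
    define k where "k = x div d"
    \<comment> \<open>The remainder of \<open>x\<close> modulo \<open>d\<close> is itself a difference of elements of \<open>\<Gamma>\<close>,
      contradicting the minimality of \<open>d\<close>.\<close>
    have "k * (n + d) \<in> \<Gamma>" "x + k * n \<in> \<Gamma>"
      using S n that additive_submonoid_mult[OF S] by (auto simp: additive_submonoid_def)
    moreover have "x + k * n = k * (n + d) + x mod d"
      using div_mult_mod_eq[of x d] by (simp add: k_def algebra_simps)
    ultimately have "P (x mod d)"
      using \<open>x mod d > 0\<close> by (auto simp: P_def)
    then have "d \<le> x mod d"
      unfolding d_def by (rule Least_le)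
    with mod_less_divisor[OF \<open>d > 0\<close>, of x] show False by simp
  qed
  then have "d dvd Gcd \<Gamma>" by (rule Gcd_greatest)
  with gcd n show ?thesis using that by simp
qed

lemma finite_gaps:
  assumes "numerical_semigroup \<Gamma>"
  shows "finite (UNIV - \<Gamma>)"
proof -
  have S: "additive_submonoid \<Gamma>"
    using assms by (simp add: numerical_semigroup_def)
  obtain n where n: "n \<in> \<Gamma>" "n + 1 \<in> \<Gamma>"
    using numerical_semigroup_consecutive[OF assms] .
  have "x \<in> \<Gamma>" if "x \<ge> n * n" for x
  proof (cases "n = 0")
    case True
    with n additive_submonoid_mult[OF S, of 1 x] show ?thesis by simp
  next
    case False
    then have "n \<le> x div n"
      using that div_le_mono[of "n * n" x n] by simp
    moreover have "x mod n < n" using False by simp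
    ultimately have le: "x mod n \<le> x div n" by linarith
    \<comment> \<open>Of the \<open>x div n\<close> copies of \<open>n\<close>, exactly \<open>x mod n\<close> are replaced by \<open>n + 1\<close>.\<close>
    have "x = x div n * n + x mod n" by simp
    also have "\<dots> = (x div n - x mod n) * n + (x mod n) * (n + 1)"
      using le by (simp add: algebra_simps flip: add_mult_distrib)
    finally show ?thesis
      using S n additive_submonoid_mult[OF S] by (metis additive_submonoid_def)
  qed
  then have "UNIV - \<Gamma> \<subseteq> {..<n * n}" by (auto simp: not_le[symmetric])
  then show ?thesis by (rule finite_subset) simp
qed

lemma conductor_le_imp_mem:
  assumes "numerical_semigroup \<Gamma>" "conductor \<Gamma> \<le> x"
  shows "x \<in> \<Gamma>"
  using Max_ge[OF finite_gaps[OF assms(1)], of x] assms(2) by (force simp: conductor_def)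

lemma multiplicity_mem:
  assumes "numerical_semigroup \<Gamma>"
  shows "multiplicity \<Gamma> \<in> \<Gamma>" "multiplicity \<Gamma> > 0"
proof -
  obtain x where "x \<in> \<Gamma> - {0}"
    using numerical_semigroup_pos_element[OF assms] by blast
  then have "multiplicity \<Gamma> \<in> \<Gamma> - {0}"
    unfolding multiplicity_def by (rule LeastI)
  then show "multiplicity \<Gamma> \<in> \<Gamma>" "multiplicity \<Gamma> > 0" by auto
qed

lemma is_minimal_generators_minimal_generators:
  assumes "additive_submonoid \<Gamma>"
  shows "is_minimal_generators (minimal_generators \<Gamma>) \<Gamma>"
  unfolding minimal_generators_def by (rule theI'[OF ex1_minimal_generators[OF assms]])

text \<open>A generator is of no use for producing elements smaller than itself. So if \<open>a\<close> and \<open>b\<close> are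
  positive, both are generated without \<open>a + b\<close>, and \<open>a + b\<close> would be a redundant generator.\<close>

lemma minimal_generator_not_sum:
  assumes S: "additive_submonoid \<Gamma>"
    and ab: "a \<in> \<Gamma>" "b \<in> \<Gamma>" "a > 0" "b > 0"
  shows "a + b \<notin> minimal_generators \<Gamma>"
proof
  define G where "G = minimal_generators \<Gamma>"
  define H where "H = additive_submonoid hull (G - {a + b})"
  assume "a + b \<in> minimal_generators \<Gamma>"
  then have mem: "a + b \<in> G" by (simp add: G_def)
  have gen: "additive_submonoid hull G = \<Gamma>"
    and minimal: "\<forall>B. B \<subset> G \<longrightarrow> \<not> generates B \<Gamma>"
    using is_minimal_generators_minimal_generators[OF S]
    by (auto simp: is_minimal_generators_def generates_def G_def)
  have H: "additive_submonoid H"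
    unfolding H_def by (rule additive_submonoid_hull)
  have sub: "G - {a + b} \<subseteq> H"
    unfolding H_def by (rule hull_subset)
  have "additive_submonoid hull G \<subseteq> H \<union> {a + b..}"
    using H sub by (intro hull_minimal) (auto simp: additive_submonoid_def)
  with gen ab have "a \<in> H" "b \<in> H" by auto
  with H have "a + b \<in> H" by (simp add: additive_submonoid_def)
  with sub have "G \<subseteq> H" by auto
  then have "\<Gamma> \<subseteq> H"
    using H gen hull_minimal by metis
  moreover have "H \<subseteq> \<Gamma>"
    unfolding H_def gen[symmetric] by (rule hull_mono) auto
  ultimately have "generates (G - {a + b}) \<Gamma>"
    by (auto simp: generates_def H_def)
  with minimal mem show False by blast
qed

lemma minimal_generator_less:
  assumes "numerical_semigroup \<Gamma>" "g \<in> minimal_generators \<Gamma>"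
  shows "g < conductor \<Gamma> + multiplicity \<Gamma>"
proof (rule ccontr)
  let ?m = "multiplicity \<Gamma>"
  assume "\<not> ?thesis"
  then have ge: "conductor \<Gamma> \<le> g - ?m" "g = ?m + (g - ?m)" by auto
  moreover have "conductor \<Gamma> > 0" by (simp add: conductor_def)
  ultimately have "g - ?m \<in> \<Gamma>" "g - ?m > 0"
    using conductor_le_imp_mem[OF assms(1)] by auto
  then have "?m + (g - ?m) \<notin> minimal_generators \<Gamma>"
    using assms(1) multiplicity_mem[OF assms(1)]
    by (intro minimal_generator_not_sum) (auto simp: numerical_semigroup_def)
  with ge assms(2) show False by simp
qed

lemma embedding_dimension_le:
  assumes "numerical_semigroup \<Gamma>"
  shows "embedding_dimension \<Gamma> \<le> e_s \<Gamma> + e_c \<Gamma>"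
proof -
  let ?A = "{g \<in> minimal_generators \<Gamma>. g < conductor \<Gamma>}"
  have "minimal_generators \<Gamma> \<subseteq> ?A \<union> pq \<Gamma>"
    using minimal_generator_less[OF assms] by (auto simp: pq_def Jq_def)
  moreover have "finite (?A \<union> pq \<Gamma>)"
    by (auto simp: pq_def Jq_def)
  ultimately have "card (minimal_generators \<Gamma>) \<le> card (?A \<union> pq \<Gamma>)"
    by (intro card_mono)
  also have "\<dots> \<le> card ?A + card (pq \<Gamma>)" by (rule card_Un_le)
  finally show ?thesis by (simp add: embedding_dimension_def e_s_def e_c_def)
qed

lemma delta_pos:
  assumes "additive_submonoid \<Gamma>"
  shows "delta \<Gamma> > 0"
proof -
  have "0 \<in> {x \<in> \<Gamma>. x < conductor \<Gamma>}"
    using assms by (simp add: additive_submonoid_def conductor_def)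
  then show ?thesis by (auto simp: delta_def card_gt_0_iff)
qed

text \<open>The Eliahou number exceeds \<open>W\<^sub>\<Gamma>(e\<^sub>s)\<close> by \<open>q (m - |d\<^sub>q|)\<close>.\<close>

lemma Wilf_e_s_le_Eliahou: "Wilf \<Gamma> (e_s \<Gamma>) \<le> Eliahou \<Gamma>"
proof -
  have "card (dq \<Gamma>) \<le> card (Jq \<Gamma>)"
    by (intro card_mono) (auto simp: dq_def Jq_def)
  then have "card (dq \<Gamma>) \<le> multiplicity \<Gamma>" by (simp add: Jq_def)
  moreover have "depth \<Gamma> \<ge> 0"
    unfolding depth_def using divide_nonneg_nonneg[of "real (conductor \<Gamma>)" "real (multiplicity \<Gamma>)"]
    by linarith
  ultimately have "depth \<Gamma> * int (card (dq \<Gamma>)) \<le> depth \<Gamma> * int (multiplicity \<Gamma>)"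
    by (intro mult_left_mono) auto
  then show ?thesis by (simp add: Eliahou_def Wilf_def nu_def)
qed

lemma Wilf_mono: "k \<le> l \<Longrightarrow> Wilf \<Gamma> k \<le> Wilf \<Gamma> l"
  by (simp add: Wilf_def mult_right_mono)

text \<open>At \<open>k = c\<close> the Wilf function is nonnegative because \<open>\<delta> \<ge> 1\<close>, so \<open>\<mu>\<close> is attained.\<close>

lemma Wilf_mu_nonneg:
  assumes "additive_submonoid \<Gamma>"
  shows "Wilf \<Gamma> (mu \<Gamma>) \<ge> 0"
proof -
  have "conductor \<Gamma> * 1 \<le> conductor \<Gamma> * delta \<Gamma>"
    using delta_pos[OF assms] by (intro mult_left_mono) auto
  then have "Wilf \<Gamma> (conductor \<Gamma>) \<ge> 0"
    by (simp add: Wilf_def flip: of_nat_mult)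
  then show ?thesis unfolding mu_def by (rule LeastI)
qed

theorem theorem4p3:
  fixes \<Gamma> :: "nat set"
  assumes "numerical_semigroup \<Gamma>"
    and "\<Gamma> \<noteq> UNIV"
    and "Eliahou \<Gamma> < 0"
  shows "Wilf \<Gamma> (embedding_dimension \<Gamma>) < int (e_c \<Gamma>) * int (delta \<Gamma>)
    \<and> mu \<Gamma> > e_s \<Gamma>"
proof
  have neg: "Wilf \<Gamma> (e_s \<Gamma>) < 0"
    using Wilf_e_s_le_Eliahou assms(3) by (rule le_less_trans)
  have "Wilf \<Gamma> (embedding_dimension \<Gamma>) \<le> Wilf \<Gamma> (e_s \<Gamma> + e_c \<Gamma>)"
    by (intro Wilf_mono embedding_dimension_le assms)
  also have "\<dots> = Wilf \<Gamma> (e_s \<Gamma>) + int (e_c \<Gamma>) * int (delta \<Gamma>)"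
    by (simp add: Wilf_def algebra_simps)
  finally show "Wilf \<Gamma> (embedding_dimension \<Gamma>) < int (e_c \<Gamma>) * int (delta \<Gamma>)"
    using neg by simp
  have "Wilf \<Gamma> (mu \<Gamma>) \<ge> 0"
    using assms(1) by (intro Wilf_mu_nonneg) (simp add: numerical_semigroup_def)
  with neg show "mu \<Gamma> > e_s \<Gamma>"
    using Wilf_mono[of "mu \<Gamma>" "e_s \<Gamma>" \<Gamma>] by linarith
qed

end
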